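(* The unbounded $n$-vertex shadow number $\mathfrak{s}_u(n)$ for $3$-dimensional convex polyhedra satisfies $\mathfrak{s}_u(n)=\Theta(1)$. In fact, $\mathfrak{s}_u(n)=3$ for all integers $n\ge 3$, and $\mathfrak{s}_u(1)=1$ and $\mathfrak{s}_u(2)=2$.
   Context: A polyhedron in $\mathbb{R}^3$ is a finite intersection of closed half-spaces; it may be bounded or unbounded. A $3$-polyhedron is a $3$-dimensional polyhedron in $\mathbb{R}^3$. Its vertices are its $0$-dimensional faces (only actual, i.e. bounded, vertices are counted, not "vertices at infinity"). For a unit vector $\mathbf{v}\in\mathbb{S}^2$, the shadow of a polyhedron $P\subset\mathbb{R}^3$ in direction $\mathbf{v}$ is the image of $P$ under the orthogonal projection of $\mathbb{R}^3$ onto the plane perpendicular to $\mathbf{v}$; it is a (possibly unbounded) polygon. Let $\mathfrak{s}(P;\mathbf{v})$ be its number of vertices. The shadow number of $P$ is $\mathfrak{s}(P)=\max\{\mathfrak{s}(P;\mathbf{v}) : \mathbf{v}\in\mathbb{S}^2\}$. For $n\ge 1$, the $n$-vertex unbounded shadow number is $$\mathfrak{s}_u(n)=\min\{\mathfrak{s}(P) : P \text{ is a (bounded or unbounded) } 3\text{-polyhedron with exactly } n \text{ vertices}\}.$$ *)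

theory Defs
  imports "HOL-Analysis.Analysis" "HOL-Library.Landau_Symbols"
begin

definition vertices :: "(real^3) set \<Rightarrow> (real^3) set set" where
  "vertices P = {F. F face_of P \<and> aff_dim F = 0}"

definition polyhedron3 :: "(real^3) set \<Rightarrow> bool" where
  "polyhedron3 P \<longleftrightarrow> polyhedron P \<and> aff_dim P = 3"

text \<open>For a unit vector \<open>v\<close>, the map below is the orthogonal projection onto the plane
  perpendicular to \<open>v\<close>. The shadow is kept as a subset of that plane inside the ambient
  space, which does not affect its faces.\<close>

definition shadow :: "real^3 \<Rightarrow> (real^3) set \<Rightarrow> (real^3) set" where
  "shadow v P = (\<lambda>x. x - (x \<bullet> v) *\<^sub>R v) ` P"

definition shadow_vertex_count :: "(real^3) set \<Rightarrow> real^3 \<Rightarrow> nat" where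
  "shadow_vertex_count P v = card (vertices (shadow v P))"

definition shadow_number :: "(real^3) set \<Rightarrow> nat" where
  "shadow_number P = Max ((\<lambda>v. shadow_vertex_count P v) ` sphere 0 1)"

text \<open>On a nonempty set of natural numbers \<open>Inf\<close> is the minimum.\<close>

definition unbounded_shadow_number :: "nat \<Rightarrow> nat" where
  "unbounded_shadow_number n =
     Inf {shadow_number P | P. polyhedron3 P \<and> card (vertices P) = n}"

text \<open>\<open>card\<close> and \<open>Max\<close> take junk values on infinite sets. For a polyhedron all the sets above
  are finite, because the preimage of a face of a shadow is a face of the polyhedron.\<close>

lemma finite_vertices:
  assumes "polyhedron P"
  shows "finite (vertices P)"
  using finite_polyhedron_faces[OF assms] by (simp add: vertices_def)

lemma linear_shadow_map: "linear (\<lambda>x::real^3. x - (x \<bullet> v) *\<^sub>R v)"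
  by (rule linearI) (simp_all add: inner_add_left scaleR_add_left scaleR_diff_right)

lemma face_of_linear_preimage:
  fixes f :: "'a::real_vector \<Rightarrow> 'b::real_vector"
  assumes f: "linear f" and P: "convex P" and T: "T face_of f ` P"
  shows "(P \<inter> f -` T) face_of P"
proof -
  have "a \<in> f -` T \<and> b \<in> f -` T"
    if ab: "a \<in> P" "b \<in> P" and x: "x \<in> P" "f x \<in> T" "x \<in> open_segment a b" for a b x
  proof -
    obtain u where u: "0 < u" "u < 1" "x = (1 - u) *\<^sub>R a + u *\<^sub>R b"
      using x(3) by (auto simp: in_segment)
    then have fx: "f x = (1 - u) *\<^sub>R f a + u *\<^sub>R f b"
      using f by (simp add: linear_add linear_scale)
    show ?thesis
    proof (cases "f a = f b")
      case True
      then have "f x = f a" using fx by (metis scaleR_collapse)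
      then show ?thesis using True x by simp
    next
      case False
      then have "f x \<in> open_segment (f a) (f b)"
        using u fx by (auto simp: in_segment)
      then show ?thesis using T[unfolded face_of_def] ab(1,2) x(2) by blast
    qed
  qed
  moreover have "convex (P \<inter> f -` T)"
    by (rule convex_Int[OF P convex_linear_vimage[OF f face_of_imp_convex[OF T]]])
  ultimately show ?thesis unfolding face_of_def by blast
qed

lemma shadow_vertices_finite_card_le:
  assumes P: "polyhedron P"
  shows "finite (vertices (shadow v P))"
    and "shadow_vertex_count P v \<le> card {F. F face_of P}"
proof -
  let ?f = "\<lambda>x::real^3. x - (x \<bullet> v) *\<^sub>R v"
  let ?g = "\<lambda>T. P \<inter> ?f -` T"
  have sub: "T \<subseteq> ?f ` P" if "T \<in> vertices (shadow v P)" for T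
    using that by (auto simp: vertices_def shadow_def face_of_def)
  have inj: "inj_on ?g (vertices (shadow v P))"
  proof (rule inj_on_inverseI)
    fix T assume "T \<in> vertices (shadow v P)"
    then show "?f ` ?g T = T" using sub[of T] by blast
  qed
  have im: "?g ` vertices (shadow v P) \<subseteq> {F. F face_of P}"
    using face_of_linear_preimage[OF linear_shadow_map polyhedron_imp_convex[OF P]]
    by (auto simp: vertices_def shadow_def)
  note fin = finite_polyhedron_faces[OF P]
  show "finite (vertices (shadow v P))"
    using inj im fin by (rule inj_on_finite)
  show "shadow_vertex_count P v \<le> card {F. F face_of P}"
    unfolding shadow_vertex_count_def using inj im fin by (rule card_inj_on_le)
qed

lemma finite_shadow_vertex_counts:
  assumes "polyhedron P"
  shows "finite ((\<lambda>v. shadow_vertex_count P v) ` sphere 0 1)"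
  using shadow_vertices_finite_card_le(2)[OF assms]
  by (auto intro: finite_subset[OF _ finite_atMost[of "card {F. F face_of P}"]])

end

theory Submission
  imports Defs
begin

text \<open>
  The minimal shadow number of a polyhedron with \<open>n \<ge> 1\<close> vertices is \<open>min n 3\<close>. Throughout, vertices
  are studied through the linear functionals that expose them. If a functional is orthogonal to the
  direction \<open>v\<close> of projection, it has the same values on a polyhedron and on its shadow. So the shadow
  vertices correspond to the vertices that are exposed, up to translation along \<open>v\<close>, by functionals in
  the plane orthogonal to \<open>v\<close>.

  Lower bound. For one or two vertices, project along a direction orthogonal to functionals exposing
  them. For three or more vertices, there is a bounded edge (\<open>polyhedron_bounded_edge_exists\<close>); project
  along a direction orthogonal to a functional exposing this edge and to one exposing a third vertex.
  The two ends of the edge and the third vertex then give three shadow vertices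
  (\<open>shadow_number_ge_3\<close>).

  Upper bound. The functionals bounded above on an unbounded polyhedron with a full-dimensional
  recession cone form a pointed cone, so a slice of it is a polygon, subdivided into one cell for each
  vertex; the shadows correspond to the lines, and their vertices to the cells that a line meets. Cut
  off \<open>k\<close> disjoint corners from a polygon, leaving one central cell. No line meets three of
  the corner caps: the middle one of three points on a line would be a convex combination of the other
  two, which lie on the far side of its cutting line. So every line meets at most three cells. In
  terms of the polyhedron, the central cell belongs to the origin, the caps belong to points
  \<open>p\<^sub>1, \<dots>, p\<^sub>k\<close>, and the caps are disjoint as soon as all sums \<open>p\<^sub>i + p\<^sub>j\<close> with \<open>i \<noteq> j\<close> are
  recession directions. For points \<open>(i, i\<^sup>2, 1)\<close> on a lifted parabola all of these caps are nonempty,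
  that is, all of the points remain vertices
  (\<open>thin_shadow_polyhedron\<close>, \<open>shadow_vertex_count_thin_shadow\<close>).
\<close>

section \<open>Functionals exposing vertices of polyhedra\<close>

definition exposes :: "'a::real_inner \<Rightarrow> 'a \<Rightarrow> 'a set \<Rightarrow> bool" where
  "exposes a w P \<longleftrightarrow> w \<in> P \<and> (\<forall>x\<in>P. x \<noteq> w \<longrightarrow> a \<bullet> x < a \<bullet> w)"

lemma exposes_le: "exposes a w P \<Longrightarrow> x \<in> P \<Longrightarrow> a \<bullet> x \<le> a \<bullet> w"
  by (metis exposes_def less_eq_real_def)

lemma exposes_imp_extreme_point:
  assumes "exposes a w P"
  shows "w extreme_point_of P"
proof (rule extreme_point_of_Int_supporting_hyperplane_le[where a = a and b = "a \<bullet> w"])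
  show "P \<inter> {x. a \<bullet> x = a \<bullet> w} = {w}"
    using assms by (force simp: exposes_def)
  show "\<And>x. x \<in> P \<Longrightarrow> a \<bullet> x \<le> a \<bullet> w"
    using assms exposes_le by blast
qed

lemma extreme_point_of_polyhedron_exposed:
  fixes P :: "'a::euclidean_space set"
  assumes "polyhedron P" "w extreme_point_of P"
  obtains a where "exposes a w P"
proof -
  have "{w} exposed_face_of P"
    using assms by (simp add: exposed_face_of_polyhedron face_of_singleton)
  then obtain a b where ab: "P \<subseteq> {x. a \<bullet> x \<le> b}" "{w} = P \<inter> {x. a \<bullet> x = b}"
    by (auto simp: exposed_face_of_def)
  have "exposes a w P"
    unfolding exposes_def
  proof (intro conjI ballI impI)
    show "w \<in> P" using ab by blast
    fix x assume x: "x \<in> P" "x \<noteq> w"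
    have "a \<bullet> w = b" "a \<bullet> x \<le> b" "a \<bullet> x \<noteq> b"
      using ab x by blast+
    then show "a \<bullet> x < a \<bullet> w" by simp
  qed
  then show ?thesis using that by blast
qed

lemma extreme_point_of_no_midpoint:
  fixes w :: "'a::euclidean_space"
  assumes "w extreme_point_of P" "w + d \<in> P" "w - d \<in> P"
  shows "d = 0"
proof (rule ccontr)
  assume "d \<noteq> 0"
  then have "w - d \<noteq> w + d"
    by (metis add_diff_cancel_left' diff_conv_add_uminus eq_neg_iff_add_eq_0 scaleR_2 scaleR_eq_0_iff zero_neq_numeral)
  then have "midpoint (w - d) (w + d) \<in> open_segment (w - d) (w + d)" by simp
  then show False using assms by (simp add: midpoint_def extreme_point_of_def)
qed

text \<open>A polyhedron has only finitely many constraints. If every functional maximised at \<open>w\<close>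
  vanished on \<open>d\<close>, then moving from \<open>w\<close> a little along \<open>d\<close> or \<open>- d\<close> would keep the tight
  constraints unchanged and the slack ones satisfied, so \<open>w\<close> would be a midpoint. This fails for
  general convex sets: at a point of a round ball all such functionals are parallel.\<close>

lemma extreme_point_tight_functional:
  fixes P :: "'a::euclidean_space set"
  assumes P: "polyhedron P" and w: "w extreme_point_of P" and d: "d \<noteq> 0"
  obtains b where "b \<bullet> d \<noteq> 0" "\<And>x. x \<in> P \<Longrightarrow> b \<bullet> x \<le> b \<bullet> w"
proof -
  obtain F where "finite F \<and> P = \<Inter>F \<and> (\<forall>h\<in>F. \<exists>a b. a \<noteq> 0 \<and> h = {x. a \<bullet> x \<le> b})"
    using P unfolding polyhedron_def ..
  then have F: "finite F" "P = \<Inter>F"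
    and half: "\<And>h. h \<in> F \<Longrightarrow> \<exists>a b. a \<noteq> 0 \<and> h = {x. a \<bullet> x \<le> b}"
    by simp_all
  have wP: "w \<in> P" using w by (simp add: extreme_point_of_def)
  have "\<exists>b. b \<bullet> d \<noteq> 0 \<and> (\<forall>x\<in>P. b \<bullet> x \<le> b \<bullet> w)"
  proof (rule ccontr)
    assume none: "\<not> ?thesis"
    have near: "\<forall>\<^sub>F e in at_right 0. w + e *\<^sub>R d \<in> h \<and> w - e *\<^sub>R d \<in> h" if h: "h \<in> F" for h
    proof -
      obtain a b where ab: "h = {x. a \<bullet> x \<le> b}" using half[OF h] by blast
      have wh: "a \<bullet> w \<le> b" using wP F(2) h ab by blast
      show ?thesis
      proof (cases "a \<bullet> w = b")
        case True
        have "\<forall>x\<in>P. a \<bullet> x \<le> a \<bullet> w" using F(2) h ab True by blast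
        then have "a \<bullet> d = 0" using none by blast
        then show ?thesis using ab True by (simp add: inner_simps)
      next
        case False
        then have lt: "a \<bullet> w < b" using wh by simp
        have "((\<lambda>e. a \<bullet> (w + e *\<^sub>R d)) \<longlongrightarrow> a \<bullet> (w + 0 *\<^sub>R d)) (at_right 0)"
          and "((\<lambda>e. a \<bullet> (w - e *\<^sub>R d)) \<longlongrightarrow> a \<bullet> (w - 0 *\<^sub>R d)) (at_right 0)"
          by (intro tendsto_intros)+
        then have "\<forall>\<^sub>F e in at_right 0. a \<bullet> (w + e *\<^sub>R d) < b"
          and "\<forall>\<^sub>F e in at_right 0. a \<bullet> (w - e *\<^sub>R d) < b"
          using lt order_tendstoD(2)[where a = b] by fastforce+
        then show ?thesis
          by eventually_elim (simp add: ab)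
      qed
    qed
    have "\<forall>\<^sub>F e in at_right 0. \<forall>h\<in>F. w + e *\<^sub>R d \<in> h \<and> w - e *\<^sub>R d \<in> h"
      using near F(1) by (simp add: eventually_ball_finite)
    moreover have "\<forall>\<^sub>F e in at_right 0. (0::real) < e"
      by (simp add: eventually_at_right_less)
    ultimately have "\<forall>\<^sub>F e in at_right (0::real). 0 < e \<and> (\<forall>h\<in>F. w + e *\<^sub>R d \<in> h \<and> w - e *\<^sub>R d \<in> h)"
      by eventually_elim blast
    then obtain e where e: "0 < e" "\<forall>h\<in>F. w + e *\<^sub>R d \<in> h \<and> w - e *\<^sub>R d \<in> h"
      using eventually_happens'[OF trivial_limit_at_right_real] by blast
    then have "w + e *\<^sub>R d \<in> P" "w - e *\<^sub>R d \<in> P" using F(2) by auto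
    then show False using extreme_point_of_no_midpoint[OF w, of "e *\<^sub>R d"] d e(1) by simp
  qed
  then show ?thesis using that by blast
qed

text \<open>The general-position device of the lower bound: adding to an exposing functional one that is
  merely maximised at \<open>w\<close> keeps it exposing, so it can be tilted away from any one hyperplane.\<close>

lemma extreme_point_exposed_nonorthogonal:
  fixes P :: "'a::euclidean_space set"
  assumes P: "polyhedron P" and w: "w extreme_point_of P" and d: "d \<noteq> 0"
  obtains a where "exposes a w P" "a \<bullet> d \<noteq> 0"
proof -
  obtain a where a: "exposes a w P"
    using extreme_point_of_polyhedron_exposed[OF P w] .
  obtain b where b: "b \<bullet> d \<noteq> 0" "\<And>x. x \<in> P \<Longrightarrow> b \<bullet> x \<le> b \<bullet> w"
    using extreme_point_tight_functional[OF P w d] by (metis (no_types))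
  have ab: "exposes (a + b) w P"
    unfolding exposes_def
  proof (intro conjI ballI impI)
    show "w \<in> P" using a by (simp add: exposes_def)
    fix x assume x: "x \<in> P" "x \<noteq> w"
    then have "a \<bullet> x < a \<bullet> w" using a by (simp add: exposes_def)
    then show "(a + b) \<bullet> x < (a + b) \<bullet> w" using b(2)[OF x(1)] by (simp add: inner_add_left)
  qed
  show ?thesis
  proof (cases "a \<bullet> d = 0")
    case True
    then show ?thesis using that[OF ab] b(1) by (simp add: inner_add_left)
  next
    case False
    then show ?thesis using that[OF a] by simp
  qed
qed

section \<open>Maxima of linear functionals at vertices\<close>

text \<open>A line in a closed convex set can be translated to pass through any of its points: the segments
  from \<open>w\<close> to far away points of the line converge to it. An extreme point would then be a midpoint.\<close>

lemma extreme_point_imp_no_line: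
  fixes P :: "'a::euclidean_space set"
  assumes P: "closed P" "convex P" and w: "w extreme_point_of P" and d: "d \<noteq> 0"
  shows "\<exists>t. x + t *\<^sub>R d \<notin> P"
proof (rule ccontr)
  assume "\<not> ?thesis"
  then have line: "x + t *\<^sub>R d \<in> P" for t by blast
  have wP: "w \<in> P" using w by (simp add: extreme_point_of_def)
  have tr: "w + c *\<^sub>R d \<in> P" for c
  proof (rule closed_sequentially[OF P(1)])
    fix n :: nat
    let ?u = "1 / real (Suc n)"
    have "(1 - ?u) *\<^sub>R w + ?u *\<^sub>R (x + (real (Suc n) * c) *\<^sub>R d) \<in> P"
      using P(2) wP line by (intro convexD) auto
    moreover have "(1 - ?u) *\<^sub>R w + ?u *\<^sub>R (x + (real (Suc n) * c) *\<^sub>R d)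
                   = w + c *\<^sub>R d + ?u *\<^sub>R (x - w)"
      by (simp add: algebra_simps del: of_nat_Suc)
    ultimately show "w + c *\<^sub>R d + ?u *\<^sub>R (x - w) \<in> P" by simp
  next
    have "(\<lambda>n. w + c *\<^sub>R d + (1 / real (Suc n)) *\<^sub>R (x - w)) \<longlonglongrightarrow> w + c *\<^sub>R d + 0 *\<^sub>R (x - w)"
      by (intro tendsto_intros LIMSEQ_Suc[OF lim_1_over_n])
    then show "(\<lambda>n. w + c *\<^sub>R d + (1 / real (Suc n)) *\<^sub>R (x - w)) \<longlonglongrightarrow> w + c *\<^sub>R d"
      by simp
  qed
  have "w + d \<in> P" using tr[of 1] by simp
  moreover have "w - d \<in> P" using tr[of "-1"] by simp
  ultimately have "d = 0" by (rule extreme_point_of_no_midpoint[OF w])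
  then show False using d by contradiction
qed

lemma closed_convex_ray_exit:
  fixes P :: "'a::real_normed_vector set"
  assumes P: "closed P" "convex P" and x: "x \<in> P" and exit: "x + r *\<^sub>R d \<notin> P" "0 \<le> r"
  obtains t where "0 \<le> t" "x + t *\<^sub>R d \<in> P" "\<And>s. t < s \<Longrightarrow> x + s *\<^sub>R d \<notin> P"
proof -
  let ?T = "{t. x + t *\<^sub>R d \<in> P} \<inter> {0..}"
  have bd: "s < r" if "s \<in> ?T" for s
  proof (rule ccontr)
    assume "\<not> s < r"
    then have s: "0 < s" "r \<le> s"
      using exit x by (cases "r = 0"; simp)+
    have "(1 - r/s) *\<^sub>R x + (r/s) *\<^sub>R (x + s *\<^sub>R d) \<in> P"
      using P(2) x that s exit(2) by (intro convexD) auto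
    moreover have "(1 - r/s) *\<^sub>R x + (r/s) *\<^sub>R (x + s *\<^sub>R d) = x + r *\<^sub>R d"
      using s by (simp add: algebra_simps)
    ultimately show False using exit(1) by simp
  qed
  have "continuous_on UNIV (\<lambda>t. x + t *\<^sub>R d)" by (intro continuous_intros)
  then have "closed ((\<lambda>t. x + t *\<^sub>R d) -` P)"
    using P(1) by (simp add: continuous_closed_vimage continuous_on_eq_continuous_at)
  then have "closed ?T" by (intro closed_Int) (auto simp: vimage_def)
  moreover have "bounded ?T"
    by (rule bounded_subset[OF bounded_closed_interval[of 0 r]]) (use bd in force)
  ultimately have "compact ?T" by (simp add: compact_eq_bounded_closed)
  moreover have "0 \<in> ?T" using x by simp
  ultimately obtain t where t: "t \<in> ?T" "\<forall>s\<in>?T. s \<le> t"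
    using compact_attains_sup[of ?T] by blast
  show ?thesis
    by (rule that[of t]) (use t in force)+
qed

text \<open>The fundamental theorem of linear programming. From a point that is not a vertex one can move
  along a segment direction without decreasing \<open>a\<close>, until the relative boundary is hit and a face
  of smaller dimension takes over. If the ray never leaves, boundedness makes \<open>a\<close> constant along it,
  and the opposite ray leaves because there is no line.\<close>

lemma bounded_functional_max_at_vertex:
  fixes P :: "'a::euclidean_space set"
  assumes "polyhedron P" "v extreme_point_of P"
    and "\<And>y. y \<in> P \<Longrightarrow> a \<bullet> y \<le> B" and "x \<in> P"
  obtains w where "w extreme_point_of P" "a \<bullet> x \<le> a \<bullet> w"
proof -
  have P: "closed P" "convex P"
    using assms(1) by (simp_all add: polyhedron_imp_closed polyhedron_imp_convex)
  note noline = extreme_point_imp_no_line[OF P assms(2)]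
  have "\<exists>w. w extreme_point_of F \<and> a \<bullet> x \<le> a \<bullet> w" if "F face_of P" "x \<in> F" for F x
    using that
  proof (induction "nat (aff_dim F + 1)" arbitrary: F x rule: less_induct)
    case less
    have F: "polyhedron F" using face_of_polyhedron_polyhedron[OF assms(1) less.prems(1)] .
    have Fc: "closed F" "convex F"
      using F by (simp_all add: polyhedron_imp_closed polyhedron_imp_convex)
    have FP: "F \<subseteq> P" using less.prems(1) by (rule face_of_imp_subset)
    have boundary: ?case if y: "y \<in> F" "y \<notin> rel_interior F" "a \<bullet> x \<le> a \<bullet> y" for y
    proof -
      obtain G where G: "G facet_of F" "y \<in> G"
        using y rel_boundary_of_polyhedron[OF F] by blast
      have GF: "G face_of F" using G(1) by (rule facet_of_imp_face_of)
      have "aff_dim G < aff_dim F"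
        using G(1) by (simp add: facet_of_def)
      then have "nat (aff_dim G + 1) < nat (aff_dim F + 1)"
        using aff_dim_geq[of G] by linarith
      then obtain w where "w extreme_point_of G" "a \<bullet> y \<le> a \<bullet> w"
        using less.hyps[OF _ face_of_trans[OF GF less.prems(1)] G(2)] by blast
      then show ?thesis
        using y(3) extreme_point_of_face[OF GF] by fastforce
    qed
    show ?case
    proof (cases "x extreme_point_of F")
      case True
      then show ?thesis by blast
    next
      case False
      then obtain p q where pq: "p \<in> F" "q \<in> F" "x \<in> open_segment p q"
        using less.prems(2) by (auto simp: extreme_point_of_def)
      \<comment> \<open>The point where the ray leaves is off the relative interior, because a segment ending in the
        relative interior can be prolonged.\<close>
      have exits: ?thesis
        if d: "a \<bullet> d \<ge> 0" and s: "0 < s" "x + s *\<^sub>R d \<in> F" and r: "0 \<le> r" "x + r *\<^sub>R d \<notin> F" for d s r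
      proof -
        obtain t where t: "0 \<le> t" "x + t *\<^sub>R d \<in> F" "\<And>s. t < s \<Longrightarrow> x + s *\<^sub>R d \<notin> F"
          using closed_convex_ray_exit[OF Fc less.prems(2) r(2,1)] by metis
        have t0: "0 < t" using t(3) s by force
        have "x + t *\<^sub>R d \<notin> rel_interior F"
        proof
          assume "x + t *\<^sub>R d \<in> rel_interior F"
          then obtain e where e: "e > 1" "(1 - e) *\<^sub>R x + e *\<^sub>R (x + t *\<^sub>R d) \<in> F"
            using convex_rel_interior_iff[OF Fc(2)] less.prems(2) by blast
          then have "x + (e * t) *\<^sub>R d \<in> F" by (simp add: algebra_simps)
          then show False using t(3)[of "e * t"] e(1) t0 by simp
        qed
        moreover have "a \<bullet> x \<le> a \<bullet> (x + t *\<^sub>R d)" using d t(1) by (simp add: inner_simps)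
        ultimately show ?thesis using boundary t(2) by blast
      qed
      obtain u where u: "0 < u" "u < 1" "x = (1 - u) *\<^sub>R p + u *\<^sub>R q" "p \<noteq> q"
        using pq(3) by (auto simp: in_segment)
      have "x + (1 - u) *\<^sub>R (q - p) = q" "x + u *\<^sub>R (p - q) = p"
        using u(3) by (simp_all add: algebra_simps)
      then have both: "\<exists>s>0. x + s *\<^sub>R (q - p) \<in> F" "\<exists>s>0. x + s *\<^sub>R (p - q) \<in> F"
        using u(1,2) pq by (metis diff_gt_0_iff_gt)+
      obtain d where d: "d \<noteq> 0" "a \<bullet> d \<ge> 0"
        and in_F: "\<exists>s>0. x + s *\<^sub>R d \<in> F" "\<exists>s>0. x + s *\<^sub>R (- d) \<in> F"
      proof (cases "a \<bullet> (q - p) \<ge> 0")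
        case True
        then show ?thesis using that[of "q - p"] both u(4) by simp
      next
        case False
        then have "a \<bullet> (p - q) \<ge> 0" by (simp add: inner_diff_right)
        then show ?thesis using that[of "p - q"] both u(4) by simp
      qed
      show ?thesis
      proof (cases "\<exists>r\<ge>0. x + r *\<^sub>R d \<notin> F")
        case True
        then show ?thesis using exits d in_F(1) by blast
      next
        case ray: False
        have "a \<bullet> d = 0"
        proof (rule ccontr)
          assume "a \<bullet> d \<noteq> 0"
          then have pos: "a \<bullet> d > 0" using d by simp
          define r where "r = (\<bar>B\<bar> + \<bar>a \<bullet> x\<bar> + 1) / (a \<bullet> d)"
          have "r \<ge> 0" using pos by (simp add: r_def)
          then have "a \<bullet> (x + r *\<^sub>R d) \<le> B" using ray FP assms(3) by blast
          moreover have "a \<bullet> (x + r *\<^sub>R d) = a \<bullet> x + (\<bar>B\<bar> + \<bar>a \<bullet> x\<bar> + 1)"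
            using pos by (simp add: inner_simps r_def)
          ultimately show False by linarith
        qed
        moreover obtain t where "x + t *\<^sub>R d \<notin> F"
        proof -
          obtain t where "x + t *\<^sub>R d \<notin> P" using noline[OF d(1)] by blast
          then show ?thesis
            using that FP by blast
        qed
        moreover from this ray have "t < 0" by (meson not_less)
        ultimately show ?thesis
          using exits[of "- d" _ "- t"] in_F(2) by auto
      qed
    qed
  qed
  then show ?thesis
    using that face_of_refl[OF P(2)] assms(4) by blast
qed

section \<open>Bounded edges\<close>

lemma extreme_points_collinear_segment:
  fixes F :: "'a::euclidean_space set"
  assumes F: "convex F" and w: "w extreme_point_of F" and w': "w' extreme_point_of F"
    and "w \<noteq> w'" and line: "\<And>z. z \<in> F \<Longrightarrow> \<exists>t. z = w + t *\<^sub>R (w' - w)"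
  shows "F = closed_segment w w'"
proof
  have beyond: False
    if "x extreme_point_of F" "y extreme_point_of F" "x \<noteq> y" "1 < r" "x + r *\<^sub>R (y - x) \<in> F" for x y r
  proof -
    have "y = (1 - 1 / r) *\<^sub>R x + (1 / r) *\<^sub>R (x + r *\<^sub>R (y - x))"
      using that(4) by (simp add: algebra_simps)
    moreover have "x \<noteq> x + r *\<^sub>R (y - x)" using that(3,4) by simp
    ultimately have "y \<in> open_segment x (x + r *\<^sub>R (y - x))"
      using that(4) unfolding in_segment by (intro conjI exI[of _ "1 / r"]) auto
    then show False using that(1,2,5) by (simp add: extreme_point_of_def)
  qed
  have in_F: "w \<in> F" "w' \<in> F" using w w' by (simp_all add: extreme_point_of_def)
  then show "closed_segment w w' \<subseteq> F" using F by (simp add: closed_segment_subset)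
  show "F \<subseteq> closed_segment w w'"
  proof
    fix z assume z: "z \<in> F"
    obtain t where t: "z = w + t *\<^sub>R (w' - w)" using line[OF z] by blast
    have "w' + (1 - t) *\<^sub>R (w - w') = z" by (simp add: t algebra_simps)
    then have "\<not> 1 - t > 1" "\<not> t > 1"
      using beyond[OF w' w, of "1 - t"] beyond[OF w w', of t] \<open>w \<noteq> w'\<close> z t by auto
    then show "z \<in> closed_segment w w'"
      unfolding in_segment by (intro exI[of _ t]) (simp add: t algebra_simps)
  qed
qed

text \<open>Turn the functional from \<open>a\<close> towards \<open>a'\<close>. The vertex \<open>w\<close> is optimal at first and stops being
  so eventually; at the first moment when another vertex \<open>u\<close> catches up, both are optimal. As \<open>w\<close>
  is then at least as good as every vertex, it is optimal on all of \<open>F\<close>, by the fundamental theorem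
  of linear programming.\<close>

lemma face_with_tied_vertices:
  fixes F :: "'a::euclidean_space set"
  assumes F: "polyhedron F" and a: "exposes a w F" and a': "exposes a' w' F" and ne: "w \<noteq> w'"
  obtains t u where "0 < t" "u extreme_point_of F" "u \<noteq> w"
    "\<And>x. x \<in> F \<Longrightarrow> (a + t *\<^sub>R a') \<bullet> x \<le> (a + t *\<^sub>R a') \<bullet> w"
    "(a + t *\<^sub>R a') \<bullet> u = (a + t *\<^sub>R a') \<bullet> w"
proof -
  have w: "w extreme_point_of F" "w' extreme_point_of F"
    using a a' exposes_imp_extreme_point by blast+
  have in_F: "w \<in> F" "w' \<in> F" using a a' by (simp_all add: exposes_def)
  define U where "U = {u. u extreme_point_of F \<and> a' \<bullet> w < a' \<bullet> u}"
  \<comment> \<open>\<open>tie u\<close> is the parameter at which \<open>u\<close> catches up with \<open>w\<close>.\<close>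
  define tie where "tie u = (a \<bullet> w - a \<bullet> u) / (a' \<bullet> u - a' \<bullet> w)" for u
  have U: "finite U"
    using finite_polyhedron_extreme_points[OF F] by (rule rev_finite_subset) (auto simp: U_def)
  have "w' \<in> U" using w a' in_F ne by (auto simp: U_def exposes_def)
  then obtain u where u: "u \<in> U" "\<And>z. z \<in> U \<Longrightarrow> tie u \<le> tie z"
    using ex_min_if_finite[of "tie ` U"] U by (auto simp: not_less)
  have uF: "u \<in> F" "u \<noteq> w" "a' \<bullet> w < a' \<bullet> u" "u extreme_point_of F"
    using u(1) by (auto simp: U_def extreme_point_of_def)
  let ?t = "tie u" and ?s = "a + tie u *\<^sub>R a'"
  have lt: "a \<bullet> z < a \<bullet> w" if "z \<in> F" "z \<noteq> w" for z
    using a that by (simp add: exposes_def)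
  have t: "0 < ?t" using lt[OF uF(1,2)] uF(3) by (simp add: tie_def)
  have tied: "?s \<bullet> u = ?s \<bullet> w"
    using uF(3) by (simp add: inner_simps tie_def field_simps)
  have vert: "?s \<bullet> z \<le> ?s \<bullet> w" if z: "z extreme_point_of F" for z
  proof (cases "z \<in> U")
    case True
    then have pos: "0 < a' \<bullet> z - a' \<bullet> w" by (simp add: U_def)
    have "?t * (a' \<bullet> z - a' \<bullet> w) \<le> a \<bullet> w - a \<bullet> z"
      using u(2)[OF True] pos by (simp add: tie_def[of z] pos_le_divide_eq)
    then show ?thesis by (simp add: inner_simps algebra_simps)
  next
    case False
    have "a \<bullet> z \<le> a \<bullet> w"
      using a z exposes_le by (auto simp: extreme_point_of_def)
    moreover have "?t * (a' \<bullet> z) \<le> ?t * (a' \<bullet> w)"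
      using False z t by (intro mult_left_mono) (auto simp: U_def)
    ultimately show ?thesis by (simp add: inner_simps)
  qed
  have "?s \<bullet> x \<le> ?s \<bullet> w" if x: "x \<in> F" for x
  proof -
    have "?s \<bullet> y \<le> a \<bullet> w + ?t * (a' \<bullet> w')" if "y \<in> F" for y
      using exposes_le[OF a that] exposes_le[OF a' that] t by (simp add: inner_simps add_mono)
    then obtain z where "z extreme_point_of F" "?s \<bullet> x \<le> ?s \<bullet> z"
      using bounded_functional_max_at_vertex[OF F w(1) _ x] by metis
    then show ?thesis using vert[of z] by linarith
  qed
  then show ?thesis using that[OF t uF(4,2) _ tied] by blast
qed

text \<open>Take a minimal face \<open>F\<close> with at least two vertices. If it had a point off the line through two
  of its vertices \<open>w\<close>, \<open>w'\<close>, the functionals exposing them could be chosen so that no positive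
  combination is constant on \<open>F\<close>; the face on which two vertices tie would then be a smaller one.
  So \<open>F\<close> lies on a line and is the segment between its vertices.\<close>

lemma polyhedron_bounded_edge_exists:
  fixes P :: "'a::euclidean_space set"
  assumes P: "polyhedron P" and w0: "w0 extreme_point_of P" "w0' extreme_point_of P" "w0 \<noteq> w0'"
  obtains w w' where "w extreme_point_of P" "w' extreme_point_of P" "w \<noteq> w'"
    "closed_segment w w' face_of P"
proof -
  define \<F> where "\<F> = {F. F face_of P \<and> (\<exists>w w'. w \<noteq> w' \<and> w extreme_point_of F \<and> w' extreme_point_of F)}"
  have "finite \<F>" using finite_polyhedron_faces[OF P] by (rule rev_finite_subset) (auto simp: \<F>_def)
  moreover have "P \<in> \<F>"
    using w0 P by (auto simp: \<F>_def face_of_refl polyhedron_imp_convex)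
  ultimately obtain F where F\<F>: "F \<in> \<F>" and minimal: "\<And>G. G \<in> \<F> \<Longrightarrow> G \<subseteq> F \<Longrightarrow> G = F"
    using finite_has_minimal[of \<F>] by (metis empty_iff)
  obtain w w' where FP: "F face_of P" and w: "w extreme_point_of F" and w': "w' extreme_point_of F"
    and ne: "w \<noteq> w'" using F\<F> by (auto simp: \<F>_def)
  have F: "polyhedron F" using face_of_polyhedron_polyhedron[OF P FP] .
  have in_F: "w \<in> F" "w' \<in> F" using w w' by (simp_all add: extreme_point_of_def)
  have "\<exists>t. z = w + t *\<^sub>R (w' - w)" if z: "z \<in> F" for z
  proof (rule ccontr)
    assume off: "\<not> ?thesis"
    obtain a' where a': "exposes a' w' F"
      using extreme_point_of_polyhedron_exposed[OF F w'] .
    have pos: "a' \<bullet> (w' - w) \<noteq> 0"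
      using a' in_F ne by (force simp: exposes_def inner_diff_right)
    \<comment> \<open>\<open>d\<close> is a direction of \<open>F\<close> on which \<open>a'\<close> vanishes. Choosing \<open>a\<close> nonzero on it makes every
      combination \<open>a + t a'\<close> nonconstant on \<open>F\<close>, whatever \<open>t\<close> is.\<close>
    define \<mu> where "\<mu> = a' \<bullet> (z - w) / (a' \<bullet> (w' - w))"
    define d where "d = (z - w) - \<mu> *\<^sub>R (w' - w)"
    have "d \<noteq> 0"
    proof
      assume "d = 0"
      then have "z = w + \<mu> *\<^sub>R (w' - w)" by (simp add: d_def algebra_simps)
      then show False using off by blast
    qed
    then obtain a where a: "exposes a w F" "a \<bullet> d \<noteq> 0"
      using extreme_point_exposed_nonorthogonal[OF F w] by metis
    have a'd: "a' \<bullet> d = 0" using pos by (simp add: d_def \<mu>_def inner_simps)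
    obtain t u where tu: "0 < t" "u extreme_point_of F" "u \<noteq> w"
      "\<And>x. x \<in> F \<Longrightarrow> (a + t *\<^sub>R a') \<bullet> x \<le> (a + t *\<^sub>R a') \<bullet> w"
      "(a + t *\<^sub>R a') \<bullet> u = (a + t *\<^sub>R a') \<bullet> w"
      using face_with_tied_vertices[OF F a(1) a' ne] by metis
    let ?s = "a + t *\<^sub>R a'"
    let ?G = "F \<inter> {x. ?s \<bullet> x = ?s \<bullet> w}"
    have GF: "?G face_of F"
      using tu(4) F by (intro face_of_Int_supporting_hyperplane_le) (auto simp: polyhedron_imp_convex)
    have "w extreme_point_of ?G" "u extreme_point_of ?G"
      using extreme_point_of_face[OF GF] w tu in_F by (auto simp: extreme_point_of_def)
    then have "?G \<in> \<F>" using face_of_trans[OF GF FP] tu(3) by (auto simp: \<F>_def)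
    then have "?G = F" using minimal by blast
    then have const: "?s \<bullet> x = ?s \<bullet> w" if "x \<in> F" for x using that by blast
    have "?s \<bullet> d = (?s \<bullet> z - ?s \<bullet> w) - \<mu> * (?s \<bullet> w' - ?s \<bullet> w)"
      by (simp only: d_def inner_diff_right inner_scaleR_right)
    also have "\<dots> = 0" using const[OF z] const[OF in_F(2)] by simp
    finally show False using a(2) a'd by (simp add: inner_add_left)
  qed
  then have seg: "F = closed_segment w w'"
    using extreme_points_collinear_segment[OF polyhedron_imp_convex[OF F] w w' ne] by blast
  have "w extreme_point_of P" "w' extreme_point_of P"
    using w w' extreme_point_of_face[OF FP] by blast+
  then show ?thesis using that ne FP seg by blast
qed

section \<open>Shadows with as many vertices as the polyhedron, up to three\<close>

lemma vertices_eq_extreme_points: "vertices P = (\<lambda>w. {w}) ` {w. w extreme_point_of P}"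
  by (auto simp: vertices_def aff_dim_eq_0 face_of_singleton)

lemma card_vertices: "card (vertices P) = card {w. w extreme_point_of P}"
  by (simp add: vertices_eq_extreme_points card_image)

abbreviation proj :: "real^3 \<Rightarrow> real^3 \<Rightarrow> real^3" where
  "proj v x \<equiv> x - (x \<bullet> v) *\<^sub>R v"

lemma inner_proj_orthogonal: "a \<bullet> v = 0 \<Longrightarrow> a \<bullet> proj v x = a \<bullet> x"
  by (simp add: inner_diff_right)

lemma exposes_shadow:
  assumes "exposes a w P" "a \<bullet> v = 0"
  shows "exposes a (proj v w) (shadow v P)"
  unfolding exposes_def
proof (intro conjI ballI impI)
  show "proj v w \<in> shadow v P" using assms(1) by (auto simp: exposes_def shadow_def)
  fix y assume y: "y \<in> shadow v P" "y \<noteq> proj v w"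
  then obtain x where x: "x \<in> P" "y = proj v x" by (auto simp: shadow_def)
  then have "a \<bullet> x < a \<bullet> w" using y(2) assms(1) by (auto simp: exposes_def)
  then show "a \<bullet> y < a \<bullet> proj v w"
    using assms(2) x(2) by (simp add: inner_proj_orthogonal)
qed

lemma unit_vector_orthogonal_to_two:
  fixes a b :: "real^3"
  obtains v where "norm v = 1" "a \<bullet> v = 0" "b \<bullet> v = 0"
proof -
  have "dim {a, b} \<le> card {a, b}" by (rule dim_le_card') simp
  also have "\<dots> \<le> 2" by (simp add: card_insert_if)
  finally have "dim {a, b} < DIM(real^3)" by simp
  then obtain c where c: "c \<noteq> 0" "span {a, b} \<subseteq> {x. c \<bullet> x = 0}"
    using lowdim_subset_hyperplane by blast
  then have "c \<bullet> a = 0" "c \<bullet> b = 0"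
    using span_base[of a "{a,b}"] span_base[of b "{a,b}"] by blast+
  then show ?thesis
    using that[of "c /\<^sub>R norm c"] c(1) by (simp add: inner_commute)
qed

lemma shadow_vertex_count_ge_card:
  assumes P: "polyhedron P" and W: "\<And>w. w \<in> W \<Longrightarrow> w extreme_point_of shadow v P"
  shows "card W \<le> shadow_vertex_count P v"
proof -
  have "finite {w. w extreme_point_of shadow v P}"
    using shadow_vertices_finite_card_le(1)[OF P, of v]
    by (simp add: vertices_eq_extreme_points finite_image_iff)
  then show ?thesis
    unfolding shadow_vertex_count_def card_vertices using W by (intro card_mono) auto
qed

lemma shadow_vertex_count_le_shadow_number:
  assumes "polyhedron P" "norm v = 1"
  shows "shadow_vertex_count P v \<le> shadow_number P"
  unfolding shadow_number_def
  using assms finite_shadow_vertex_counts[OF assms(1)] by (intro Max_ge) auto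

text \<open>For \<open>v\<close> orthogonal to \<open>s\<close>, the functional \<open>s\<close> takes the same values on \<open>P\<close> and on its shadow.
  It therefore cuts out of the shadow exactly the projection of the edge, a segment or a point.\<close>

lemma shadow_of_edge_ends:
  assumes P: "polyhedron P" and s: "s \<bullet> v = 0"
    and edge: "closed_segment p q = P \<inter> {x. s \<bullet> x = b}" "\<And>x. x \<in> P \<Longrightarrow> s \<bullet> x \<le> b"
  shows "proj v p extreme_point_of shadow v P" "proj v q extreme_point_of shadow v P"
proof -
  let ?S = "shadow v P"
  let ?T = "?S \<inter> {y. s \<bullet> y = b}"
  have "convex ?S"
    unfolding shadow_def by (intro convex_linear_image linear_shadow_map polyhedron_imp_convex P)
  then have T: "?T face_of ?S"
    using edge(2) s
    by (intro face_of_Int_supporting_hyperplane_le) (auto simp: shadow_def inner_proj_orthogonal)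
  have "?T = proj v ` closed_segment p q"
    unfolding edge(1) using s by (auto simp: shadow_def inner_proj_orthogonal)
  also have "\<dots> = closed_segment (proj v p) (proj v q)"
    using closed_segment_linear_image[OF linear_shadow_map[of v], of p q] by simp
  finally have "proj v p extreme_point_of ?T" "proj v q extreme_point_of ?T"
    by (simp_all add: extreme_point_of_segment)
  then show "proj v p extreme_point_of ?S" "proj v q extreme_point_of ?S"
    using extreme_point_of_face[OF T] by blast+
qed

text \<open>Project along a direction orthogonal to a functional \<open>s\<close> exposing a bounded edge and to a functional
  \<open>a\<close> exposing a third vertex. Then the edge projects to a face and the third vertex to a vertex of
  the shadow. Tilting \<open>a\<close> so that it separates the two ends of the edge keeps their images
  distinct.\<close>

lemma shadow_number_ge_3:
  assumes P: "polyhedron P" and n: "3 \<le> card (vertices P)"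
  shows "3 \<le> shadow_number P"
proof -
  let ?V = "{w. w extreme_point_of P}"
  have fin: "finite ?V" using finite_polyhedron_extreme_points[OF P] .
  have n3: "3 \<le> card ?V" using n by (simp add: card_vertices)
  have third: "\<exists>w\<in>?V. w \<noteq> p \<and> w \<noteq> q" for p q
  proof (rule ccontr)
    assume "\<not> ?thesis"
    then have "?V \<subseteq> {p, q}" by blast
    then have "card ?V \<le> card {p, q}" by (intro card_mono) auto
    also have "\<dots> \<le> 2" by (simp add: card_insert_if)
    finally show False using n3 by simp
  qed
  obtain w0 where "w0 extreme_point_of P" using third by blast
  moreover obtain w0' where "w0' extreme_point_of P" "w0' \<noteq> w0" using third[of w0] by blast
  ultimately obtain p q where pq: "p extreme_point_of P" "q extreme_point_of P" "p \<noteq> q"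
    and edge: "closed_segment p q face_of P"
    using polyhedron_bounded_edge_exists[OF P] by metis
  obtain w where w: "w extreme_point_of P" "w \<noteq> p" "w \<noteq> q" using third by blast
  have "closed_segment p q exposed_face_of P" using edge P by (simp add: exposed_face_of_polyhedron)
  then obtain s b where s: "P \<subseteq> {x. s \<bullet> x \<le> b}" "closed_segment p q = P \<inter> {x. s \<bullet> x = b}"
    by (auto simp: exposed_face_of_def)
  obtain a where a: "exposes a w P" "a \<bullet> (p - q) \<noteq> 0"
    using extreme_point_exposed_nonorthogonal[OF P w(1), of "p - q"] pq(3) by auto
  obtain v where v: "norm v = 1" "a \<bullet> v = 0" "s \<bullet> v = 0"
    using unit_vector_orthogonal_to_two .
  have in_P: "p \<in> P" "q \<in> P" using pq by (simp_all add: extreme_point_of_def)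
  have "proj v p \<noteq> proj v q" "proj v w \<noteq> proj v p" "proj v w \<noteq> proj v q"
    using a w(2,3) in_P v(2) inner_proj_orthogonal[OF v(2)]
    by (metis inner_diff_right eq_iff_diff_eq_0 exposes_def order_less_irrefl)+
  then have "card {proj v w, proj v p, proj v q} = 3" by simp
  moreover have "card {proj v w, proj v p, proj v q} \<le> shadow_vertex_count P v"
    using exposes_imp_extreme_point[OF exposes_shadow[OF a(1) v(2)]]
      shadow_of_edge_ends[OF P v(3) s(2)] s(1)
    by (intro shadow_vertex_count_ge_card[OF P]) auto
  ultimately show ?thesis
    using shadow_vertex_count_le_shadow_number[OF P v(1)] by linarith
qed

lemma shadow_number_ge_2:
  assumes P: "polyhedron P" and n: "card (vertices P) = 2"
  shows "2 \<le> shadow_number P"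
proof -
  obtain p q where V: "{w. w extreme_point_of P} = {p, q}" "p \<noteq> q"
    using n by (auto simp: card_vertices card_2_iff)
  then obtain a b where ab: "exposes a p P" "exposes b q P"
    using extreme_point_of_polyhedron_exposed[OF P] by (metis insertCI mem_Collect_eq)
  obtain v where v: "norm v = 1" "a \<bullet> v = 0" "b \<bullet> v = 0"
    using unit_vector_orthogonal_to_two .
  have "proj v p \<noteq> proj v q"
    using ab V(2) inner_proj_orthogonal[OF v(2)] by (metis exposes_def order_less_irrefl)
  then have "2 = card {proj v p, proj v q}" by simp
  also have "\<dots> \<le> shadow_vertex_count P v"
    using exposes_imp_extreme_point[OF exposes_shadow[OF ab(1) v(2)]]
      exposes_imp_extreme_point[OF exposes_shadow[OF ab(2) v(3)]]
    by (intro shadow_vertex_count_ge_card[OF P]) auto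
  finally show ?thesis using shadow_vertex_count_le_shadow_number[OF P v(1)] by linarith
qed

lemma shadow_number_ge_1:
  assumes P: "polyhedron P" and n: "card (vertices P) = 1"
  shows "1 \<le> shadow_number P"
proof -
  obtain p where "p extreme_point_of P"
    using n by (auto simp: card_vertices card_1_singleton_iff)
  then obtain a where a: "exposes a p P"
    using extreme_point_of_polyhedron_exposed[OF P] by metis
  obtain v where v: "norm v = 1" "a \<bullet> v = 0"
    using unit_vector_orthogonal_to_two[of a a] .
  have "1 = card {proj v p}" by simp
  also have "\<dots> \<le> shadow_vertex_count P v"
    using exposes_imp_extreme_point[OF exposes_shadow[OF a v(2)]]
    by (intro shadow_vertex_count_ge_card[OF P]) auto
  finally show ?thesis using shadow_vertex_count_le_shadow_number[OF P v(1)] by linarith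
qed

section \<open>Polyhedra generated by points and directions\<close>

text \<open>The homogenisation: points are put at height one, directions at height zero, so that convex
  combinations of points plus nonnegative combinations of directions form the slice at height one of
  a finitely generated cone.\<close>

definition homog :: "'a::real_vector set \<Rightarrow> 'a set \<Rightarrow> ('a \<times> real) set" where
  "homog V C = (\<lambda>p. (p, 1)) ` V \<union> (\<lambda>c. (c, 0)) ` C"

definition generated :: "'a::real_vector set \<Rightarrow> 'a set \<Rightarrow> 'a set" where
  "generated V C = {x. (x, 1) \<in> convex_cone hull homog V C}"

text \<open>By Weyl's theorem the cone over the homogenisation is polyhedral, and a half-space meets height one
  in a half-space, the empty set or everything.\<close>

lemma polyhedron_generated:
  fixes V C :: "'a::euclidean_space set"
  assumes "finite V" "finite C"
  shows "polyhedron (generated V C)"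
proof -
  have "polyhedron (convex_cone hull homog V C)"
    using assms by (intro polyhedron_convex_cone_hull) (simp add: homog_def)
  then obtain F where F: "finite F \<and> convex_cone hull homog V C = \<Inter>F
      \<and> (\<forall>h\<in>F. \<exists>a b. a \<noteq> 0 \<and> h = {x. a \<bullet> x \<le> b})"
    unfolding polyhedron_def ..
  have "polyhedron {x. (x, 1) \<in> h}" if h: "h \<in> F" for h
  proof -
    obtain a b where ab: "h = {x. a \<bullet> x \<le> b}" using F h by blast
    have "{x. (x, 1) \<in> h} = {x. fst a \<bullet> x \<le> b - snd a}"
      by (cases a) (auto simp: ab inner_Pair)
    then show ?thesis by (simp add: polyhedron_halfspace_le)
  qed
  then have "polyhedron (\<Inter>((\<lambda>h. {x. (x, 1) \<in> h}) ` F))"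
    using F by (intro polyhedron_Inter) auto
  moreover have "\<Inter>((\<lambda>h. {x. (x, 1) \<in> h}) ` F) = generated V C"
    unfolding generated_def using F by auto
  ultimately show ?thesis by simp
qed

lemma generators_subset_generated: "V \<subseteq> generated V C"
  by (auto simp: generated_def homog_def intro: hull_inc)

lemma generated_add_direction:
  assumes "x \<in> generated V C" "c \<in> C" "0 \<le> t"
  shows "x + t *\<^sub>R c \<in> generated V C"
proof -
  have "(c, 0) \<in> convex_cone hull homog V C"
    using assms(2) by (auto simp: homog_def intro: hull_inc)
  then have "(x, 1) + t *\<^sub>R (c, 0) \<in> convex_cone hull homog V C"
    using assms by (intro convex_cone_add convex_cone_scaleR convex_cone_convex_cone_hull)
      (simp_all add: generated_def)
  then show ?thesis by (simp add: generated_def)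
qed

lemma generated_linear_image:
  assumes f: "linear f"
  shows "f ` generated V C = generated (f ` V) (f ` C)"
proof -
  let ?g = "map_prod f (id :: real \<Rightarrow> real)"
  have "linear ?g"
    using f by (intro linearI) (auto simp: linear_add linear_scale split: prod.splits)
  then have "convex_cone hull (?g ` homog V C) = ?g ` (convex_cone hull homog V C)"
    by (rule convex_cone_hull_linear_image)
  moreover have "?g ` homog V C = homog (f ` V) (f ` C)"
    by (simp add: homog_def image_Un image_image)
  ultimately show ?thesis
    by (force simp: generated_def)
qed

lemma generated_le:
  fixes a :: "'a::euclidean_space"
  assumes "\<And>p. p \<in> V \<Longrightarrow> a \<bullet> p \<le> b" "\<And>c. c \<in> C \<Longrightarrow> a \<bullet> c \<le> 0" "x \<in> generated V C"
  shows "a \<bullet> x \<le> b"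
proof -
  have "convex_cone hull homog V C \<subseteq> {z. (a, - b) \<bullet> z \<le> 0}"
    using assms(1,2) by (intro hull_minimal convex_cone_halfspace_le) (auto simp: homog_def)
  then show ?thesis using assms(3) by (auto simp: generated_def)
qed

text \<open>It is enough to compare the generators. In the homogenisation, the points where the functional
  \<open>(a, - (a \<bullet> w))\<close> is negative together with the ray through \<open>(w, 1)\<close> form a convex cone \<open>K\<close>;
  it contains all generators, and at height one only \<open>w\<close> is not strictly worse.\<close>

lemma exposes_generated:
  fixes a :: "'a::euclidean_space"
  assumes w: "w \<in> V" and V: "\<And>p. p \<in> V \<Longrightarrow> p \<noteq> w \<Longrightarrow> a \<bullet> p < a \<bullet> w"
    and C: "\<And>c. c \<in> C \<Longrightarrow> a \<bullet> c < 0"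
  shows "exposes a w (generated V C)"
  unfolding exposes_def
proof (intro conjI ballI impI)
  show "w \<in> generated V C" using w generators_subset_generated by blast
  fix x assume x: "x \<in> generated V C" "x \<noteq> w"
  define K where "K = {z. (a, - (a \<bullet> w)) \<bullet> z < 0} \<union> {l *\<^sub>R (w, 1) | l. 0 \<le> l}"
  have ray: "(a, - (a \<bullet> w)) \<bullet> z = 0" if "z \<in> {l *\<^sub>R (w, 1::real) | l. 0 \<le> l}" for z
    using that by auto
  have "convex_cone K"
    unfolding convex_cone_iff
  proof (intro conjI ballI allI impI)
    show "0 \<in> K" by (auto simp: K_def zero_prod_def intro!: exI[of _ 0])
    fix y assume y: "y \<in> K"
    show "y + z \<in> K" if z: "z \<in> K" for z
    proof (cases "(a, - (a \<bullet> w)) \<bullet> y < 0 \<or> (a, - (a \<bullet> w)) \<bullet> z < 0")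
      case True
      moreover have "(a, - (a \<bullet> w)) \<bullet> y \<le> 0" "(a, - (a \<bullet> w)) \<bullet> z \<le> 0"
        using y z ray by (fastforce simp: K_def)+
      ultimately have "(a, - (a \<bullet> w)) \<bullet> (y + z) < 0" unfolding inner_add_right by linarith
      then show ?thesis by (simp add: K_def)
    next
      case False
      then obtain l m where "0 \<le> l" "0 \<le> m" "y = l *\<^sub>R (w, 1)" "z = m *\<^sub>R (w, 1)"
        using y z by (auto simp: K_def)
      then have "0 \<le> l + m" "y + z = (l + m) *\<^sub>R (w, 1)" by (simp_all add: algebra_simps)
      then show ?thesis unfolding K_def by blast
    qed
    show "t *\<^sub>R y \<in> K" if t: "0 \<le> t" for t
    proof (cases "t = 0")
      case True
      then show ?thesis by (auto simp: K_def zero_prod_def intro!: exI[of _ 0])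
    next
      case False
      from y consider "(a, - (a \<bullet> w)) \<bullet> y < 0" | l where "0 \<le> l" "y = l *\<^sub>R (w, 1)"
        unfolding K_def by blast
      then show ?thesis
      proof cases
        case 1
        then have "(a, - (a \<bullet> w)) \<bullet> (t *\<^sub>R y) < 0"
          using t False unfolding inner_scaleR_right by (simp add: mult_pos_neg)
        then show ?thesis by (simp add: K_def)
      next
        case 2
        then have "0 \<le> t * l" "t *\<^sub>R y = (t * l) *\<^sub>R (w, 1)" using t by simp_all
        then show ?thesis unfolding K_def by blast
      qed
    qed
  qed
  moreover have "homog V C \<subseteq> K"
  proof
    fix z assume "z \<in> homog V C"
    then consider p where "p \<in> V" "z = (p, 1)" | c where "c \<in> C" "z = (c, 0)"
      by (auto simp: homog_def)
    then show "z \<in> K"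
    proof cases
      case 1
      show ?thesis
      proof (cases "p = w")
        case True
        then have "z = 1 *\<^sub>R (w, 1)" using 1 by simp
        then show ?thesis unfolding K_def using zero_le_one by blast
      next
        case False
        then show ?thesis using 1 V by (simp add: K_def)
      qed
    next
      case 2
      then show ?thesis using C by (simp add: K_def)
    qed
  qed
  ultimately have "convex_cone hull homog V C \<subseteq> K" by (intro hull_minimal)
  then have "(x, 1) \<in> K" using x(1) by (auto simp: generated_def)
  then show "a \<bullet> x < a \<bullet> w"
    using x(2) by (auto simp: K_def)
qed

lemma generated_bounded_functional_direction:
  fixes a :: "'a::euclidean_space"
  assumes x: "x \<in> generated V C" and bd: "\<And>y. y \<in> generated V C \<Longrightarrow> a \<bullet> y \<le> b" and c: "c \<in> C"
  shows "a \<bullet> c \<le> 0"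
proof (rule ccontr)
  assume "\<not> ?thesis"
  then have pos: "0 < a \<bullet> c" by simp
  define t where "t = (\<bar>b\<bar> + \<bar>a \<bullet> x\<bar> + 1) / (a \<bullet> c)"
  have "a \<bullet> (x + t *\<^sub>R c) \<le> b"
    using bd generated_add_direction[OF x c, of t] pos by (simp add: t_def)
  moreover have "a \<bullet> (x + t *\<^sub>R c) = a \<bullet> x + (\<bar>b\<bar> + \<bar>a \<bullet> x\<bar> + 1)"
    using pos by (simp add: inner_simps t_def)
  ultimately show False by linarith
qed

text \<open>A functional exposing a point outside \<open>V\<close> would be bounded above on the whole polyhedron by its
  maximum over \<open>V\<close>, which is smaller than its value at that point.\<close>

lemma extreme_point_of_generated:
  fixes V C :: "'a::euclidean_space set"
  assumes fin: "finite V" "finite C" and ne: "V \<noteq> {}" and w: "w extreme_point_of generated V C"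
  shows "w \<in> V"
proof (rule ccontr)
  assume wV: "w \<notin> V"
  obtain a where a: "exposes a w (generated V C)"
    using extreme_point_of_polyhedron_exposed[OF polyhedron_generated[OF fin] w] .
  have wP: "w \<in> generated V C" using a by (simp add: exposes_def)
  have C: "a \<bullet> c \<le> 0" if "c \<in> C" for c
    using generated_bounded_functional_direction[OF wP exposes_le[OF a] that] .
  define b where "b = Max ((\<bullet>) a ` V)"
  have "a \<bullet> p \<le> b" if "p \<in> V" for p using that fin by (simp add: b_def)
  then have "a \<bullet> w \<le> b" using generated_le C wP by blast
  moreover have "b \<in> (\<bullet>) a ` V" unfolding b_def using fin ne by (intro Max_in) auto
  then obtain p where "p \<in> V" "b = a \<bullet> p" by blast
  then have "b < a \<bullet> w"
    using a wV generators_subset_generated by (metis exposes_def subsetD)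
  ultimately show False by simp
qed

section \<open>Polyhedra with many vertices but few shadow vertices\<close>

text \<open>The lifts to height one of the points \<open>(i, i\<^sup>2)\<close> of a parabola. These points
  are in convex position, so each can be strictly separated from the others.\<close>

definition corner :: "nat \<Rightarrow> real^3" where
  "corner i = vector [real i, (real i)\<^sup>2, 1]"

definition corners :: "nat \<Rightarrow> (real^3) set" where
  "corners k = insert 0 (corner ` {1..k})"

definition corner_sums :: "nat \<Rightarrow> (real^3) set" where
  "corner_sums m = {corner i + corner j | i j. i \<in> {1..m} \<and> j \<in> {1..m} \<and> i \<noteq> j}"

text \<open>The vertices are the origin and \<open>k\<close> corners. The pairwise sums of corners are directions of the
  recession cone, which makes it impossible for a functional bounded above on the polyhedron to be
  positive on two corners. Three further corners contribute to the directions only: they make the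
  polyhedron full-dimensional also when \<open>k < 3\<close>.\<close>

definition thin_shadow_polyhedron :: "nat \<Rightarrow> (real^3) set" where
  "thin_shadow_polyhedron k = generated (corners k) (corner_sums (k + 3))"

lemma finite_corners: "finite (corners k)" by (simp add: corners_def)

lemma finite_corner_sums: "finite (corner_sums m)"
proof -
  have "corner_sums m \<subseteq> (\<lambda>(i, j). corner i + corner j) ` ({1..m} \<times> {1..m})"
    by (auto simp: corner_sums_def)
  then show ?thesis by (rule finite_subset) simp
qed

lemma polyhedron_thin_shadow: "polyhedron (thin_shadow_polyhedron k)"
  unfolding thin_shadow_polyhedron_def
  by (intro polyhedron_generated finite_corners finite_corner_sums)

text \<open>The functional with value \<open>1 - 3 (j - i)\<^sup>2\<close> at \<open>corner j\<close>: it cuts a thin cap at the \<open>i\<close>-th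
  point off the parabola. The factor 3 makes it at most \<open>-2\<close> at all other corners, hence negative on
  every sum of two distinct corners.\<close>

definition corner_functional :: "nat \<Rightarrow> real^3" where
  "corner_functional i = vector [6 * real i, - 3, 1 - 3 * (real i)\<^sup>2]"

lemma corner_functional: "corner_functional i \<bullet> corner j = 1 - 3 * (real j - real i)\<^sup>2"
  by (simp add: corner_functional_def corner_def inner_vec_def sum_3 power2_eq_square algebra_simps)

lemma corner_functional_neg:
  assumes "i \<noteq> j"
  shows "corner_functional i \<bullet> corner j \<le> - 2"
proof -
  have "1 \<le> \<bar>real j - real i\<bar>" using assms by (cases i j rule: linorder_cases) auto
  then have "1 \<le> (real j - real i)\<^sup>2"
    by (metis abs_le_square_iff abs_one one_power2)
  then show ?thesis by (simp add: corner_functional)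
qed

lemma inj_corner: "inj corner"
  by (rule injI) (metis corner_def vector_3(1) of_nat_eq_iff)

lemma corner_nonzero: "corner i \<noteq> 0"
  by (metis corner_def vector_3(3) zero_index zero_neq_one)

lemma extreme_points_thin_shadow:
  "{w. w extreme_point_of thin_shadow_polyhedron k} = corners k"
proof
  show "{w. w extreme_point_of thin_shadow_polyhedron k} \<subseteq> corners k"
    unfolding thin_shadow_polyhedron_def
    using extreme_point_of_generated[OF finite_corners finite_corner_sums]
    by (auto simp: corners_def)
  have zero: "exposes (vector [0, 0, - 1]) 0 (thin_shadow_polyhedron k)"
    unfolding thin_shadow_polyhedron_def
    by (rule exposes_generated)
      (auto simp: corners_def corner_sums_def corner_def inner_vec_def sum_3)
  have corner: "exposes (corner_functional i) (corner i) (thin_shadow_polyhedron k)"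
    if i: "i \<in> {1..k}" for i
    unfolding thin_shadow_polyhedron_def
  proof (rule exposes_generated)
    show "corner i \<in> corners k" using i by (simp add: corners_def)
    fix p assume "p \<in> corners k" "p \<noteq> corner i"
    then consider "p = 0" | j where "p = corner j" "i \<noteq> j" by (auto simp: corners_def)
    then show "corner_functional i \<bullet> p < corner_functional i \<bullet> corner i"
    proof cases
      case 1
      then show ?thesis by (simp add: corner_functional)
    next
      case 2
      then show ?thesis using corner_functional_neg[OF 2(2)] corner_functional[of i i] by simp
    qed
  next
    fix c assume "c \<in> corner_sums (k + 3)"
    then obtain j l where c: "c = corner j + corner l" "j \<noteq> l" by (auto simp: corner_sums_def)
    have one: "corner_functional i \<bullet> corner i = 1" by (simp add: corner_functional)
    have "corner_functional i \<bullet> corner j \<le> 1" "corner_functional i \<bullet> corner l \<le> 1"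
      by (simp_all add: corner_functional)
    moreover have "corner_functional i \<bullet> corner j \<le> - 2 \<or> corner_functional i \<bullet> corner l \<le> - 2"
      using c(2) corner_functional_neg by metis
    ultimately show "corner_functional i \<bullet> c < 0" unfolding c(1) inner_add_right by linarith
  qed
  show "corners k \<subseteq> {w. w extreme_point_of thin_shadow_polyhedron k}"
    using exposes_imp_extreme_point[OF zero] exposes_imp_extreme_point[OF corner]
    by (auto simp: corners_def)
qed

lemma card_vertices_thin_shadow: "card (vertices (thin_shadow_polyhedron k)) = k + 1"
proof -
  have "card (corners k) = Suc (card (corner ` {1..k}))"
    using corner_nonzero by (auto simp: corners_def card_insert_if)
  also have "card (corner ` {1..k}) = k"
    by (simp add: card_image inj_on_subset[OF inj_corner])
  finally show ?thesis by (simp add: card_vertices extreme_points_thin_shadow)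
qed

text \<open>The sums of the first three corners are already linearly independent.\<close>

lemma polyhedron3_thin_shadow: "polyhedron3 (thin_shadow_polyhedron k)"
proof -
  let ?P = "thin_shadow_polyhedron k"
  have zero: "0 \<in> ?P"
    unfolding thin_shadow_polyhedron_def
    by (rule subsetD[OF generators_subset_generated]) (simp add: corners_def)
  have sums: "corner i + corner j \<in> ?P" if "i \<in> {1..3}" "j \<in> {1..3}" "i \<noteq> j" for i j
  proof -
    have "corner i + corner j \<in> corner_sums (k + 3)"
      using that by (force simp: corner_sums_def)
    from generated_add_direction[OF zero[unfolded thin_shadow_polyhedron_def] this, of 1]
    show ?thesis by (simp add: thin_shadow_polyhedron_def)
  qed
  have "span ?P = UNIV"
  proof (rule ccontr)
    assume "span ?P \<noteq> UNIV"
    then obtain a where a: "a \<noteq> 0" "span ?P \<subseteq> {x. a \<bullet> x = 0}"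
      using span_not_univ_subset_hyperplane by blast
    then have "a \<bullet> (corner i + corner j) = 0" if "i \<in> {1..3}" "j \<in> {1..3}" "i \<noteq> j" for i j
      using sums[OF that] span_base by blast
    from this[of 1 2] this[of 1 3] this[of 2 3]
    have "a $ 1 = 0" "a $ 2 = 0" "a $ 3 = 0"
      by (simp_all add: corner_def inner_vec_def sum_3 algebra_simps)
    then have "a = 0" by (simp add: vec_eq_iff forall_3)
    then show False using a(1) by simp
  qed
  moreover have "affine hull ?P = span ?P"
    using zero by (simp add: affine_hull_span_0 hull_inc)
  ultimately have "aff_dim ?P = int DIM(real^3)" by (subst aff_dim_eq_full) simp
  then show ?thesis by (simp add: polyhedron3_def polyhedron_thin_shadow)
qed

lemma three_orthogonal_vectors_dependent:
  fixes a b c v :: "real^3"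
  assumes "v \<noteq> 0" "a \<bullet> v = 0" "b \<bullet> v = 0" "c \<bullet> v = 0"
  obtains x y z where "x *\<^sub>R a + y *\<^sub>R b + z *\<^sub>R c = 0" "x \<noteq> 0 \<or> y \<noteq> 0 \<or> z \<noteq> 0"
proof -
  let ?f = "\<lambda>l::real^3. l$1 *\<^sub>R a + l$2 *\<^sub>R b + l$3 *\<^sub>R c"
  have lin: "linear ?f" by (rule linearI) (simp_all add: algebra_simps)
  have "?f l \<noteq> v" for l
  proof
    assume "?f l = v"
    then have "v \<bullet> v = ?f l \<bullet> v" by simp
    also have "\<dots> = 0" using assms by (simp add: inner_simps)
    finally show False using assms(1) by simp
  qed
  then have "v \<notin> range ?f" by (auto simp del: scaleR_eq_0_iff)
  then have "\<not> surj ?f" by (metis UNIV_I)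
  then have "\<not> inj ?f" using linear_injective_imp_surjective[OF lin] by blast
  then obtain l where "?f l = 0" "l \<noteq> 0" using linear_injective_0[OF lin] by blast
  then show ?thesis using that[of "l$1" "l$2" "l$3"] by (auto simp: vec_eq_iff forall_3)
qed

text \<open>Each functional is positive on its own vector and at most zero on the sum of that vector with
  another one, so it is negative on both others. If two coefficients are nonnegative, evaluating the
  relation at the vector of the remaining functional shows that this coefficient is nonnegative too.
  All three functionals being negative at \<open>p + q + r\<close>, all coefficients vanish.\<close>

lemma diagonal_sign_pattern_nonneg:
  fixes a b c p q r :: "'a::real_inner"
  assumes diag: "0 < a \<bullet> p" "0 < b \<bullet> q" "0 < c \<bullet> r"
    and a: "a \<bullet> (p + q) \<le> 0" "a \<bullet> (p + r) \<le> 0"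
    and b: "b \<bullet> (q + p) \<le> 0" "b \<bullet> (q + r) \<le> 0"
    and c: "c \<bullet> (r + p) \<le> 0" "c \<bullet> (r + q) \<le> 0"
    and dep: "x *\<^sub>R a + y *\<^sub>R b + z *\<^sub>R c = 0" and "0 \<le> y" "0 \<le> z"
  shows "x = 0 \<and> y = 0 \<and> z = 0"
proof -
  have dep': "x * (a \<bullet> d) + y * (b \<bullet> d) + z * (c \<bullet> d) = 0" for d
    using arg_cong[OF dep, of "\<lambda>u. u \<bullet> d"] by (simp add: inner_add_left)
  have "0 \<le> x"
  proof (rule ccontr)
    assume "\<not> 0 \<le> x"
    then have "x * (a \<bullet> p) < 0" using diag by (simp add: mult_neg_pos)
    moreover have "y * (b \<bullet> p) \<le> 0" "z * (c \<bullet> p) \<le> 0"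
      using diag b c \<open>0 \<le> y\<close> \<open>0 \<le> z\<close> by (auto intro!: mult_nonneg_nonpos simp: inner_add_right)
    ultimately show False using dep'[of p] by linarith
  qed
  let ?e = "p + q + r"
  have neg: "a \<bullet> ?e < 0" "b \<bullet> ?e < 0" "c \<bullet> ?e < 0"
    using diag a b c by (simp_all add: inner_add_right)
  have "x * (a \<bullet> ?e) \<le> 0" "y * (b \<bullet> ?e) \<le> 0" "z * (c \<bullet> ?e) \<le> 0"
    using neg \<open>0 \<le> x\<close> \<open>0 \<le> y\<close> \<open>0 \<le> z\<close> by (simp_all add: mult_nonneg_nonpos)
  then have "x * (a \<bullet> ?e) = 0" "y * (b \<bullet> ?e) = 0" "z * (c \<bullet> ?e) = 0"
    using dep'[of ?e] by linarith+
  then show ?thesis using neg by simp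
qed

text \<open>Of three real numbers two have the same sign, and the relation may be negated.\<close>

lemma diagonal_sign_pattern_independent:
  fixes a b c p q r :: "'a::real_inner"
  assumes diag: "0 < a \<bullet> p" "0 < b \<bullet> q" "0 < c \<bullet> r"
    and a: "a \<bullet> (p + q) \<le> 0" "a \<bullet> (p + r) \<le> 0"
    and b: "b \<bullet> (q + p) \<le> 0" "b \<bullet> (q + r) \<le> 0"
    and c: "c \<bullet> (r + p) \<le> 0" "c \<bullet> (r + q) \<le> 0"
    and dep: "x *\<^sub>R a + y *\<^sub>R b + z *\<^sub>R c = 0"
  shows "x = 0 \<and> y = 0 \<and> z = 0"
proof -
  have dep': "(- x) *\<^sub>R a + (- y) *\<^sub>R b + (- z) *\<^sub>R c = 0"
    using arg_cong[OF dep, of uminus] by simp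
  have *: "y *\<^sub>R b + x *\<^sub>R a + z *\<^sub>R c = 0" "z *\<^sub>R c + x *\<^sub>R a + y *\<^sub>R b = 0"
    "(- y) *\<^sub>R b + (- x) *\<^sub>R a + (- z) *\<^sub>R c = 0" "(- z) *\<^sub>R c + (- x) *\<^sub>R a + (- y) *\<^sub>R b = 0"
    using dep dep' by (simp_all only: add_ac)
  note first = diagonal_sign_pattern_nonneg[OF diag a b c]
    and second = diagonal_sign_pattern_nonneg[OF diag(2,1,3) b a c(2,1)]
    and third = diagonal_sign_pattern_nonneg[OF diag(3,1,2) c a(2,1) b(2,1)]
  consider "0 \<le> y" "0 \<le> z" | "0 \<le> x" "0 \<le> z" | "0 \<le> x" "0 \<le> y"
    | "y \<le> 0" "z \<le> 0" | "x \<le> 0" "z \<le> 0" | "x \<le> 0" "y \<le> 0"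
    by linarith
  then show ?thesis
  proof cases
    case 1 then show ?thesis using first[OF dep] by simp
  next
    case 2 then show ?thesis using second[OF *(1)] by simp
  next
    case 3 then show ?thesis using third[OF *(2)] by simp
  next
    case 4 then show ?thesis using first[OF dep'] by simp
  next
    case 5 then show ?thesis using second[OF *(3)] by simp
  next
    case 6 then show ?thesis using third[OF *(4)] by simp
  qed
qed

lemma shadow_thin_shadow:
  "shadow v (thin_shadow_polyhedron k) = generated (proj v ` corners k) (proj v ` corner_sums (k + 3))"
  unfolding shadow_def thin_shadow_polyhedron_def by (rule generated_linear_image[OF linear_shadow_map])

lemma extreme_points_shadow_thin_shadow:
  "{y. y extreme_point_of shadow v (thin_shadow_polyhedron k)} \<subseteq> proj v ` corners k"
  unfolding shadow_thin_shadow
  using extreme_point_of_generated[of "proj v ` corners k" "proj v ` corner_sums (k + 3)"]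
    finite_corners finite_corner_sums
  by (auto simp: corners_def)

text \<open>A functional exposing \<open>y\<close> in the shadow may be taken orthogonal to \<open>v\<close>, and then it has the same
  values on the polyhedron as on the shadow. It is positive at \<open>y\<close> because the shadow contains the
  origin, and nonpositive on the directions because it is bounded above.\<close>

lemma shadow_extreme_point_functional:
  assumes v: "norm v = 1" and y: "y extreme_point_of shadow v (thin_shadow_polyhedron k)" "y \<noteq> 0"
  obtains a i where "a \<bullet> v = 0" "i \<in> {1..k}" "y = proj v (corner i)" "0 < a \<bullet> corner i"
    "\<And>c. c \<in> corner_sums (k + 3) \<Longrightarrow> a \<bullet> c \<le> 0"
proof -
  let ?S = "shadow v (thin_shadow_polyhedron k)"
  let ?V = "proj v ` corners k" and ?C = "proj v ` corner_sums (k + 3)"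
  obtain i where i: "i \<in> {1..k}" "y = proj v (corner i)"
    using extreme_points_shadow_thin_shadow[of v k] y by (auto simp: corners_def)
  have "polyhedron ?S"
    unfolding shadow_thin_shadow by (intro polyhedron_generated finite_imageI finite_corners finite_corner_sums)
  then obtain a where a: "exposes a y ?S"
    using extreme_point_of_polyhedron_exposed y(1) by metis
  have v1: "v \<bullet> v = 1" using v by (simp add: norm_eq_1)
  define a' where "a' = proj v a"
  have a': "a' \<bullet> v = 0" "a' \<bullet> x = a \<bullet> proj v x" for x
    using v1 by (simp_all add: a'_def inner_simps inner_commute)
  have "0 \<in> ?V" by (rule image_eqI[of _ _ 0]) (simp_all add: corners_def)
  then have "0 \<in> ?S" unfolding shadow_thin_shadow by (rule subsetD[OF generators_subset_generated])
  moreover have "\<forall>x\<in>?S. x \<noteq> y \<longrightarrow> a \<bullet> x < a \<bullet> y" using a by (simp add: exposes_def)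
  ultimately have "0 \<noteq> y \<longrightarrow> a \<bullet> 0 < a \<bullet> y" by (rule bspec[rotated])
  then have "a \<bullet> 0 < a \<bullet> y" using y(2) by simp
  then have pos: "0 < a' \<bullet> corner i" by (simp only: a'(2) i(2) inner_zero_right)
  have "a' \<bullet> c \<le> 0" if "c \<in> corner_sums (k + 3)" for c
  proof -
    have "y \<in> generated ?V ?C" "\<And>z. z \<in> generated ?V ?C \<Longrightarrow> a \<bullet> z \<le> a \<bullet> y"
      using a exposes_le[OF a] by (simp_all add: exposes_def shadow_thin_shadow)
    then have "a \<bullet> proj v c \<le> 0"
      by (rule generated_bounded_functional_direction) (assumption | rule imageI[OF that])+
    then show ?thesis by (simp only: a'(2))
  qed
  then show ?thesis using that a'(1) i pos by blast
qed

text \<open>Three shadow vertices other than the origin would come with three linearly independent functionals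
  orthogonal to \<open>v\<close>, but only a plane is available.\<close>

lemma shadow_vertex_count_thin_shadow:
  assumes v: "norm v = 1"
  shows "shadow_vertex_count (thin_shadow_polyhedron k) v \<le> min (k + 1) 3"
proof -
  let ?E = "{y. y extreme_point_of shadow v (thin_shadow_polyhedron k)}"
  have count: "shadow_vertex_count (thin_shadow_polyhedron k) v = card ?E"
    by (simp add: shadow_vertex_count_def card_vertices)
  have fin: "finite ?E"
    by (rule finite_subset[OF extreme_points_shadow_thin_shadow finite_imageI[OF finite_corners]])
  have "card ?E \<le> card (proj v ` corners k)"
    by (rule card_mono[OF finite_imageI[OF finite_corners] extreme_points_shadow_thin_shadow])
  also have "\<dots> \<le> card (corners k)" by (intro card_image_le finite_corners)
  also have "\<dots> = k + 1"
    using card_vertices_thin_shadow by (simp add: card_vertices extreme_points_thin_shadow)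
  finally have n: "card ?E \<le> k + 1" .
  have "\<not> 3 \<le> card (?E - {0})"
  proof
    assume "3 \<le> card (?E - {0})"
    then obtain T where T: "T \<subseteq> ?E - {0}" "card T = 3"
      using obtain_subset_with_card_n by metis
    then obtain y1 y2 y3 where y: "T = {y1, y2, y3}" "y1 \<noteq> y2" "y1 \<noteq> y3" "y2 \<noteq> y3"
      by (auto simp: card_3_iff)
    then have E: "y1 extreme_point_of shadow v (thin_shadow_polyhedron k)" "y1 \<noteq> 0"
      "y2 extreme_point_of shadow v (thin_shadow_polyhedron k)" "y2 \<noteq> 0"
      "y3 extreme_point_of shadow v (thin_shadow_polyhedron k)" "y3 \<noteq> 0"
      using T(1) by auto
    obtain a i where a: "a \<bullet> v = 0" "i \<in> {1..k}" "y1 = proj v (corner i)" "0 < a \<bullet> corner i"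
      "\<And>c. c \<in> corner_sums (k + 3) \<Longrightarrow> a \<bullet> c \<le> 0"
      using shadow_extreme_point_functional[OF v E(1,2)] by metis
    obtain b j where b: "b \<bullet> v = 0" "j \<in> {1..k}" "y2 = proj v (corner j)" "0 < b \<bullet> corner j"
      "\<And>c. c \<in> corner_sums (k + 3) \<Longrightarrow> b \<bullet> c \<le> 0"
      using shadow_extreme_point_functional[OF v E(3,4)] by metis
    obtain c l where c: "c \<bullet> v = 0" "l \<in> {1..k}" "y3 = proj v (corner l)" "0 < c \<bullet> corner l"
      "\<And>d. d \<in> corner_sums (k + 3) \<Longrightarrow> c \<bullet> d \<le> 0"
      using shadow_extreme_point_functional[OF v E(5,6)] by metis
    have sums: "corner m + corner n \<in> corner_sums (k + 3)"
      if "m \<in> {1..k}" "n \<in> {1..k}" "m \<noteq> n" for m n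
      using that by (force simp: corner_sums_def)
    have ne: "i \<noteq> j" "i \<noteq> l" "j \<noteq> l" using y a(3) b(3) c(3) by auto
    have "v \<noteq> 0" using v by auto
    then obtain x y z where xyz: "x *\<^sub>R a + y *\<^sub>R b + z *\<^sub>R c = 0"
      "x \<noteq> 0 \<or> y \<noteq> 0 \<or> z \<noteq> 0"
      by (rule three_orthogonal_vectors_dependent[OF _ a(1) b(1) c(1)])
    have "x = 0 \<and> y = 0 \<and> z = 0"
      by (rule diagonal_sign_pattern_independent[OF a(4) b(4) c(4) _ _ _ _ _ _ xyz(1)])
        (intro a(5) b(5) c(5) sums a(2) b(2) c(2) ne ne[symmetric])+
    then show False using xyz(2) by blast
  qed
  moreover have "card ?E \<le> Suc (card (?E - {0}))"
  proof (cases "0 \<in> ?E")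
    case True
    then show ?thesis by (rule eq_refl[OF card_Suc_Diff1[OF fin, symmetric]])
  next
    case False
    then have "?E - {0} = ?E" by blast
    then show ?thesis by (simp only: le_SucI)
  qed
  ultimately have "card ?E \<le> 3" by linarith
  then show ?thesis unfolding count using n by (intro min.boundedI)
qed

lemma shadow_number_thin_shadow: "shadow_number (thin_shadow_polyhedron k) \<le> min (k + 1) 3"
proof -
  have "sphere (0::real^3) 1 \<noteq> {}" by (simp add: sphere_eq_empty)
  then have "Max ((\<lambda>v. shadow_vertex_count (thin_shadow_polyhedron k) v) ` sphere 0 1) \<le> min (k + 1) 3"
    using finite_shadow_vertex_counts[OF polyhedron_thin_shadow, of k] shadow_vertex_count_thin_shadow
    by (subst Max_le_iff) (auto simp del: min.bounded_iff)
  then show ?thesis by (simp add: shadow_number_def)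
qed


theorem theorem1p5:
  shows "(\<lambda>n. real (unbounded_shadow_number n)) \<in> \<Theta>(\<lambda>_. 1) \<and>
         (\<forall>n\<ge>3. unbounded_shadow_number n = 3) \<and>
         unbounded_shadow_number 1 = 1 \<and>
         unbounded_shadow_number 2 = 2"
proof -
  have exact: "unbounded_shadow_number n = min n 3" if n: "n \<ge> 1" for n
  proof -
    let ?A = "{shadow_number P | P. polyhedron3 P \<and> card (vertices P) = n}"
    have lower: "min n 3 \<le> m" if m: "m \<in> ?A" for m
    proof -
      obtain P where P: "m = shadow_number P" "polyhedron P" "card (vertices P) = n"
        using m by (auto simp: polyhedron3_def)
      consider "n = 1" | "n = 2" | "n \<ge> 3" using n by linarith
      then show ?thesis
        using shadow_number_ge_1[OF P(2)] shadow_number_ge_2[OF P(2)] shadow_number_ge_3[OF P(2)]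
        by cases (simp_all add: P(1,3))
    qed
    have "card (vertices (thin_shadow_polyhedron (n - 1))) = n"
      using n by (simp add: card_vertices_thin_shadow)
    then have mem: "shadow_number (thin_shadow_polyhedron (n - 1)) \<in> ?A"
      using polyhedron3_thin_shadow by blast
    then have "Inf ?A \<le> shadow_number (thin_shadow_polyhedron (n - 1))"
      by (rule cInf_lower) simp
    also have "\<dots> \<le> min n 3"
      using shadow_number_thin_shadow[of "n - 1"] n by simp
    finally have "Inf ?A \<le> min n 3" .
    moreover have "min n 3 \<le> Inf ?A"
      using mem by (intro cInf_greatest lower) auto
    ultimately show ?thesis unfolding unbounded_shadow_number_def by (rule order.antisym)
  qed
  then have ge3: "\<forall>n\<ge>3. unbounded_shadow_number n = 3" by simp
  then have "eventually (\<lambda>n. real (unbounded_shadow_number n) = 3) at_top"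
    by (auto intro: eventually_at_top_linorderI[of 3])
  then have "(\<lambda>n. real (unbounded_shadow_number n)) \<in> \<Theta>(\<lambda>_. 3)"
    by (rule bigthetaI_cong)
  then show ?thesis using ge3 exact[of 1] exact[of 2] by simp
qed

end
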